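(* Let $F:\mathbb{R}^n\rightrightarrows\mathbb{R}^n$ be a set-valued mapping with graph locally closed around $(\bar x,\bar y)\in\mathrm{gph}\,F$, and assume that $F$ is SCD regular around $(\bar x,\bar y)$. Then for every $\kappa>\mathrm{scd\,reg}\,F(\bar x,\bar y)$ there is a neighborhood $W$ of $(\bar x,\bar y)$ such that $F$ is strongly metrically subregular with modulus $\mathrm{subreg}\,F(x,y)<\kappa$ at every point $(x,y)\in\mathrm{gph}\,F\cap W$ where $F$ is SCD semismooth$^*$.
   Context: Norms are Euclidean; $\mathcal{B}_\delta(z)$ is the closed ball. $\mathrm{gph}\,F=\{(x,y)\mid y\in F(x)\}$. For a set $A$ and $\bar z\in A$, the tangent cone $T_A(\bar z)$ is the set of all $w$ for which there are $t_k\downarrow0$, $w_k\to w$ with $\bar z+t_kw_k\in A$ for all $k$. $\mathcal{Z}_n$ is the set of $n$-dimensional linear subspaces of $\mathbb{R}^{2n}=\mathbb{R}^n\times\mathbb{R}^n$ with metric $d_{\mathcal{Z}}(L_1,L_2)=\|P_1-P_2\|$, $P_i$ the orthogonal projection onto $L_i$. $L^*:=\{(-v^*,u^* )\mid(u^*,v^* )\in L^\perp\}$. $\mathcal{Z}_n^{\rm reg}$ is the set of all $L\in\mathcal{Z}_n$ such that $(y^*,0)\in L\Rightarrow y^*=0$. $\mathcal{O}_F$ is the set of $(x,y)\in\mathrm{gph}\,F$ with $T_{\mathrm{gph}\,F}(x,y)\in\mathcal{Z}_n$. For $(x,y)\in\mathrm{gph}\,F$, $\mathcal{S}^*F(x,y)$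 is the set of all $L\in\mathcal{Z}_n$ for which there is a sequence $(x_k,y_k)\to(x,y)$ in $\mathcal{O}_F$ with $d_{\mathcal{Z}}(L,T_{\mathrm{gph}\,F}(x_k,y_k)^* )\to0$; $\bigcup\mathcal{S}^*F(x,y)$ is the union of these subspaces. $F$ has the SCD property at $(x,y)$ if $\mathcal{S}^*F(x,y)\neq\emptyset$, and around $(x,y)$ if it has it at all points of $\mathrm{gph}\,F$ in some neighborhood of $(x,y)$. $F$ is SCD regular around $(x,y)$ if it has the SCD property around $(x,y)$ and $\mathcal{S}^*F(x,y)\subseteq\mathcal{Z}_n^{\rm reg}$; $\mathrm{scd\,reg}\,F(x,y):=\sup\{\|y^*\|\mid(y^*,x^* )\in\bigcup\mathcal{S}^*F(x,y),\ \|x^*\|\le1\}$. $F$ is SCD semismooth$^*$ at $(\tilde x,\tilde y)\in\mathrm{gph}\,F$ if $F$ has the SCD property around $(\tilde x,\tilde y)$ and for every $\epsilon>0$ there is $\delta>0$ such that $|\langle x^*,x-\tilde x\rangle-\langle y^*,y-\tilde y\rangle|\le\epsilon\|(x,y)-(\tilde x,\tilde y)\|\,\|(x^*,y^* )\|$ for all $(x,y)\in\mathrm{gph}\,F\cap\mathcal{B}_\delta(\tilde x,\tilde y)$ and all $(y^*,x^* )\in\bigcup\mathcal{S}^*F(x,y)$. $F$ is metrically subregular at $(x,y)\in\mathrm{gph}\,F$ if there are $\kappa\ge0$ and a neighborhood $X$ of $x$ with $\mathrm{dist}(x',F^{-1}(y))\le\kappa\,\mathrm{dist}(y,F(x'))$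 for all $x'\in X$; $\mathrm{subreg}\,F(x,y)$ is the infimum of such $\kappa$ (over all neighborhoods $X$). $F$ is strongly metrically subregular at $(x,y)$ if, in addition, $F^{-1}(y)\cap X'=\{x\}$ for some neighborhood $X'$ of $x$. *)

theory Defs
  imports "HOL-Analysis.Analysis"
begin

text \<open>Set-valued mappings on an \<open>n\<close>-dimensional Euclidean space are functions
  \<open>'a \<Rightarrow> 'a set\<close> with \<open>n = DIM('a)\<close>. The product type \<open>'a \<times> 'a\<close>
  carries the Euclidean norm and inner product of the \<open>2n\<close>-dimensional space.\<close>

definition gph :: "('a \<Rightarrow> 'b set) \<Rightarrow> ('a \<times> 'b) set" where
  "gph F = {(x, y). y \<in> F x}"

definition preimg :: "('a \<Rightarrow> 'b set) \<Rightarrow> 'b \<Rightarrow> 'a set" where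
  "preimg F y = {x. y \<in> F x}"

definition locally_closed_around :: "'a::metric_space set \<Rightarrow> 'a \<Rightarrow> bool" where
  "locally_closed_around A z \<longleftrightarrow> (\<exists>r>0. closed (A \<inter> cball z r))"

definition tangent_cone :: "'a::real_normed_vector set \<Rightarrow> 'a \<Rightarrow> 'a set" where
  "tangent_cone A z = {w. \<exists>(t::nat \<Rightarrow> real) (v::nat \<Rightarrow> 'a).
     (\<forall>k. t k > 0) \<and> t \<longlonglongrightarrow> 0 \<and> v \<longlonglongrightarrow> w \<and> (\<forall>k. z + t k *\<^sub>R v k \<in> A)}"

definition Zn :: "('a::euclidean_space \<times> 'a) set set" where
  "Zn = {L. subspace L \<and> dim L = DIM('a)}"

definition Zn_reg :: "('a::euclidean_space \<times> 'a) set set" where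
  "Zn_reg = {L \<in> Zn. \<forall>ystar. (ystar, 0) \<in> L \<longrightarrow> ystar = 0}"

definition orth_proj :: "'a::euclidean_space set \<Rightarrow> 'a \<Rightarrow> 'a" where
  "orth_proj L z = (THE p. p \<in> L \<and> z - p \<in> orthogonal_comp L)"

definition dZ :: "('a::euclidean_space \<times> 'a) set \<Rightarrow> ('a \<times> 'a) set \<Rightarrow> real" where
  "dZ L1 L2 = onorm (\<lambda>z. orth_proj L1 z - orth_proj L2 z)"

definition adj_subspace :: "('a::euclidean_space \<times> 'a) set \<Rightarrow> ('a \<times> 'a) set" where
  "adj_subspace L = {(- vstar, ustar) | ustar vstar. (ustar, vstar) \<in> orthogonal_comp L}"

definition OF_pts :: "('a::euclidean_space \<Rightarrow> 'a set) \<Rightarrow> ('a \<times> 'a) set" where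
  "OF_pts F = {z \<in> gph F. tangent_cone (gph F) z \<in> Zn}"

definition Sstar :: "('a::euclidean_space \<Rightarrow> 'a set) \<Rightarrow> 'a \<Rightarrow> 'a \<Rightarrow> ('a \<times> 'a) set set" where
  "Sstar F x y = {L \<in> Zn. \<exists>z::nat \<Rightarrow> 'a \<times> 'a. (\<forall>k. z k \<in> OF_pts F) \<and> z \<longlonglongrightarrow> (x, y) \<and>
     (\<lambda>k. dZ L (adj_subspace (tangent_cone (gph F) (z k)))) \<longlonglongrightarrow> 0}"

definition scd_property_at :: "('a::euclidean_space \<Rightarrow> 'a set) \<Rightarrow> 'a \<Rightarrow> 'a \<Rightarrow> bool" where
  "scd_property_at F x y \<longleftrightarrow> Sstar F x y \<noteq> {}"

definition scd_property_around :: "('a::euclidean_space \<Rightarrow> 'a set) \<Rightarrow> 'a \<Rightarrow> 'a \<Rightarrow> bool" where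
  "scd_property_around F x y \<longleftrightarrow>
     (\<exists>U. open U \<and> (x, y) \<in> U \<and> (\<forall>(x', y') \<in> gph F \<inter> U. scd_property_at F x' y'))"

definition scd_regular_around :: "('a::euclidean_space \<Rightarrow> 'a set) \<Rightarrow> 'a \<Rightarrow> 'a \<Rightarrow> bool" where
  "scd_regular_around F x y \<longleftrightarrow> scd_property_around F x y \<and> Sstar F x y \<subseteq> Zn_reg"

text \<open>The moduli are extended reals: the supremum is \<open>\<infinity>\<close> for an unbounded set
  and the infimum is \<open>\<infinity>\<close> for an empty one.\<close>

definition scd_reg :: "('a::euclidean_space \<Rightarrow> 'a set) \<Rightarrow> 'a \<Rightarrow> 'a \<Rightarrow> ereal" where
  "scd_reg F x y =
     Sup {ereal (norm ystar) | ystar xstar. (ystar, xstar) \<in> \<Union>(Sstar F x y) \<and> norm xstar \<le> 1}"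

definition scd_semismooth_at :: "('a::euclidean_space \<Rightarrow> 'a set) \<Rightarrow> 'a \<Rightarrow> 'a \<Rightarrow> bool" where
  "scd_semismooth_at F x0 y0 \<longleftrightarrow> (x0, y0) \<in> gph F \<and> scd_property_around F x0 y0 \<and>
     (\<forall>\<epsilon>>0. \<exists>\<delta>>0. \<forall>(x, y) \<in> gph F \<inter> cball (x0, y0) \<delta>. \<forall>(ystar, xstar) \<in> \<Union>(Sstar F x y).
        \<bar>xstar \<bullet> (x - x0) - ystar \<bullet> (y - y0)\<bar>
          \<le> \<epsilon> * norm ((x, y) - (x0, y0)) * norm (xstar, ystar))"

text \<open>Distance to a set with value \<open>\<infinity>\<close> for the empty set, whereas
  \<^const>\<open>infdist\<close> would be \<open>0\<close> there. This matters for \<open>dist(y, F(x'))\<close>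
  when \<open>x'\<close> is outside the domain of \<open>F\<close>.\<close>

definition set_edist :: "'a::metric_space \<Rightarrow> 'a set \<Rightarrow> ereal" where
  "set_edist z A = (INF a\<in>A. ereal (dist z a))"

text \<open>For \<open>\<kappa> = 0\<close> and \<open>F x'\<close> empty the right-hand side below is
  \<open>0 * \<infinity> = 0\<close>. The choice of this convention affects neither metric subregularity nor
  the modulus, as enlarging \<open>\<kappa>\<close> preserves the inequality under either convention
  and positive \<open>\<kappa>\<close> are not concerned.\<close>

definition subreg_const :: "('a::euclidean_space \<Rightarrow> 'a set) \<Rightarrow> 'a \<Rightarrow> 'a \<Rightarrow> real \<Rightarrow> bool" where
  "subreg_const F x y \<kappa> \<longleftrightarrow> \<kappa> \<ge> 0 \<and>
     (\<exists>X. open X \<and> x \<in> X \<and> (\<forall>x'\<in>X. set_edist x' (preimg F y) \<le> ereal \<kappa> * set_edist y (F x')))"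

definition metrically_subregular :: "('a::euclidean_space \<Rightarrow> 'a set) \<Rightarrow> 'a \<Rightarrow> 'a \<Rightarrow> bool" where
  "metrically_subregular F x y \<longleftrightarrow> (x, y) \<in> gph F \<and> (\<exists>\<kappa>. subreg_const F x y \<kappa>)"

definition subreg :: "('a::euclidean_space \<Rightarrow> 'a set) \<Rightarrow> 'a \<Rightarrow> 'a \<Rightarrow> ereal" where
  "subreg F x y = Inf {ereal \<kappa> | \<kappa>. subreg_const F x y \<kappa>}"

definition strongly_metrically_subregular ::
    "('a::euclidean_space \<Rightarrow> 'a set) \<Rightarrow> 'a \<Rightarrow> 'a \<Rightarrow> bool" where
  "strongly_metrically_subregular F x y \<longleftrightarrow> metrically_subregular F x y \<and>
     (\<exists>X. open X \<and> x \<in> X \<and> preimg F y \<inter> X = {x})"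

end

theory Submission
  imports Defs
begin

text \<open>Orthogonal projections of fixed rank form a compact set, so by a diagonal argument the limits of
  subspaces in \<open>S\<^sup>*F(z\<^sub>k)\<close> with \<open>z\<^sub>k \<rightarrow> z\<close> lie in \<open>S\<^sup>*F(z)\<close>. Hence for every
  \<open>\<kappa>\<close> above the regularity modulus, \<open>\<parallel>y\<^sup>*\<parallel> \<le> \<kappa> \<parallel>x\<^sup>*\<parallel>\<close> holds on all subspaces of
  \<open>S\<^sup>*F\<close> at points near the reference point. By dimension, such a subspace contains
  \<open>(y\<^sup>*, x' - x)\<close> for some \<open>y\<^sup>*\<close>, and inserting this element into the semismoothness
  inequality at a point \<open>(x', y')\<close> of the graph near \<open>(x, y)\<close> bounds \<open>\<parallel>x' - x\<parallel>\<close> by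
  \<open>\<kappa> \<parallel>y' - y\<parallel>\<close> up to an error of small order.\<close>

section \<open>Orthogonal projections onto subspaces\<close>

text \<open>Two candidates for the projection differ by a vector lying both in \<open>L\<close> and
  in its orthogonal complement, hence by zero. This makes the definite description in
  \<open>orth_proj\<close> usable.\<close>

lemma orth_proj_eqI:
  assumes "subspace L" "p \<in> L" "z - p \<in> orthogonal_comp L"
  shows "orth_proj L z = p"
  unfolding orth_proj_def
proof (rule the_equality)
  fix q assume q: "q \<in> L \<and> z - q \<in> orthogonal_comp L"
  have "(z - q) - (z - p) \<in> orthogonal_comp L"
    using q assms(3) subspace_orthogonal_comp subspace_diff by blast
  then have "p - q \<in> orthogonal_comp L" by simp
  moreover have "p - q \<in> L" using q assms subspace_diff by blast
  ultimately have "orthogonal (p - q) (p - q)" by (simp add: orthogonal_comp_def)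
  then show "q = p" by (simp add: orthogonal_def)
qed (use assms in blast)

lemma
  assumes "subspace L"
  shows orth_proj_mem: "orth_proj L z \<in> L"
    and orth_proj_compl: "z - orth_proj L z \<in> orthogonal_comp L"
proof -
  obtain y w where "y \<in> span L" "\<And>v. v \<in> span L \<Longrightarrow> orthogonal w v" "z = y + w"
    using orthogonal_subspace_decomp_exists by blast
  then have "y \<in> L" "z - y \<in> orthogonal_comp L"
    using assms by (auto simp: orthogonal_comp_def orthogonal_commute span_eq_iff[THEN iffD2])
  then show "orth_proj L z \<in> L" "z - orth_proj L z \<in> orthogonal_comp L"
    using orth_proj_eqI assms by metis+
qed

lemma orth_proj_fixed:
  assumes "subspace L" "z \<in> L" shows "orth_proj L z = z"
  using assms by (intro orth_proj_eqI) (auto simp: orthogonal_comp_def orthogonal_def)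

lemma linear_orth_proj:
  assumes "subspace L" shows "linear (orth_proj L)"
proof (rule linearI)
  note mem = orth_proj_mem[OF assms] orth_proj_compl[OF assms] and C = subspace_orthogonal_comp[of L]
  fix x y :: 'a and c :: real
  have "(x - orth_proj L x) + (y - orth_proj L y) \<in> orthogonal_comp L"
    using mem C subspace_add by blast
  then show "orth_proj L (x + y) = orth_proj L x + orth_proj L y"
    using mem assms by (intro orth_proj_eqI) (auto simp: algebra_simps subspace_add)
  have "c *\<^sub>R (x - orth_proj L x) \<in> orthogonal_comp L"
    using mem C subspace_scale by blast
  then show "orth_proj L (c *\<^sub>R x) = c *\<^sub>R orth_proj L x"
    using mem assms by (intro orth_proj_eqI) (auto simp: algebra_simps subspace_scale)
qed

lemma bounded_linear_orth_proj: "subspace L \<Longrightarrow> bounded_linear (orth_proj L)"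
  using linear_orth_proj linear_conv_bounded_linear by blast

text \<open>The residual of \<open>y\<close> is orthogonal to every vector of \<open>L\<close>.
  Written as an identity between values of the projection alone, this survives limits of projections
  onto varying subspaces.\<close>

lemma inner_orth_proj:
  assumes "subspace L"
  shows "orth_proj L x \<bullet> y = orth_proj L x \<bullet> orth_proj L y"
proof -
  have "orthogonal (orth_proj L x) (y - orth_proj L y)"
    using orth_proj_mem[OF assms] orth_proj_compl[OF assms] by (auto simp: orthogonal_comp_def)
  then show ?thesis by (simp add: orthogonal_def inner_diff_right)
qed

lemma norm_orth_proj_le:
  assumes "subspace L" shows "norm (orth_proj L z) \<le> norm z"
proof -
  have "norm (orth_proj L z) * norm (orth_proj L z) \<le> norm (orth_proj L z) * norm z"
    using inner_orth_proj[OF assms, of z z] norm_cauchy_schwarz[of "orth_proj L z" z]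
    by (simp add: dot_square_norm power2_eq_square)
  then show ?thesis by (cases "orth_proj L z = 0") auto
qed

section \<open>Compactness of the set of subspaces of fixed dimension\<close>

text \<open>The projection onto \<open>M\<close> is injective on \<open>L\<close>: for a nonzero
  \<open>z\<close> in \<open>L\<close> that it kills, the two projections would differ at
  \<open>z\<close> by exactly \<open>norm z\<close>.\<close>

lemma dim_le_of_close:
  fixes L :: "'e::euclidean_space set"
  assumes "subspace L" "subspace M"
    and close: "\<And>z. z \<noteq> 0 \<Longrightarrow> norm (orth_proj L z - orth_proj M z) < norm z"
  shows "dim L \<le> dim M"
proof -
  have lin: "linear (orth_proj M)" using linear_orth_proj assms by blast
  have "inj_on (orth_proj M) L"
  proof (rule inj_onI)
    fix x y assume "x \<in> L" "y \<in> L" "orth_proj M x = orth_proj M y"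
    then have "x - y \<in> L" "orth_proj M (x - y) = 0"
      using lin assms by (auto simp: linear_diff subspace_diff)
    then show "x = y" using close[of "x - y"] orth_proj_fixed[OF assms(1)] by force
  qed
  then have "dim (orth_proj M ` L) = dim L"
    using dim_image_eq[OF lin, of L] assms by (simp add: span_eq_iff[THEN iffD2])
  moreover have "orth_proj M ` L \<subseteq> M" using orth_proj_mem[OF assms(2)] by blast
  ultimately show ?thesis using dim_subset by metis
qed

text \<open>Projections have operator norm at most one, so a subsequence converges in the
  finite-dimensional operator space. The identity characterizing orthogonal projections passes to
  the limit, which is therefore the projection onto its own range. Projections at distance less than
  one have ranges of equal dimension.\<close>

lemma subspaces_sequentially_compact:
  fixes S :: "nat \<Rightarrow> 'e::euclidean_space set"
  assumes S: "\<And>k. subspace (S k)" and d: "\<And>k. dim (S k) = d"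
  obtains L r where "subspace L" "dim L = d" "strict_mono (r :: nat \<Rightarrow> nat)"
    "(\<lambda>k. onorm (\<lambda>z. orth_proj L z - orth_proj (S (r k)) z)) \<longlonglongrightarrow> 0"
proof -
  \<comment> \<open>Bundling the projections as bounded linear functions gives access to the
    operator norm and to the Heine-Borel property.\<close>
  define P where "P k = Blinfun (orth_proj (S k))" for k
  have P: "blinfun_apply (P k) = orth_proj (S k)" for k
    unfolding P_def using bounded_linear_orth_proj[OF S] by (simp add: bounded_linear_Blinfun_apply)
  have "norm (P k) \<le> 1" for k
    by (rule norm_blinfun_bound) (simp_all add: P norm_orth_proj_le[OF S])
  then have "bounded (range P)" by (auto simp: bounded_iff)
  then obtain Q r where r: "strict_mono (r :: nat \<Rightarrow> nat)" and Q: "(P \<circ> r) \<longlonglongrightarrow> Q"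
    using bounded_imp_convergent_subsequence by blast
  have lim: "(\<lambda>k. P (r k) (v k)) \<longlonglongrightarrow> Q w" if "v \<longlonglongrightarrow> w" for v w
    using blinfun.tendsto[OF Q that] by simp
  have idem: "Q (Q z) = Q z" for z
  proof -
    have "(\<lambda>k. P (r k) (P (r k) z)) \<longlonglongrightarrow> Q (Q z)" by (intro lim tendsto_const)
    moreover have "P (r k) (P (r k) z) = P (r k) z" for k
      by (simp add: P orth_proj_fixed[OF S] orth_proj_mem[OF S])
    ultimately show ?thesis using lim[OF tendsto_const, of z] LIMSEQ_unique by auto
  qed
  have sym: "Q x \<bullet> y = Q x \<bullet> Q y" for x y
  proof -
    have "(\<lambda>k. P (r k) x \<bullet> y) \<longlonglongrightarrow> Q x \<bullet> y" "(\<lambda>k. P (r k) x \<bullet> P (r k) y) \<longlonglongrightarrow> Q x \<bullet> Q y"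
      by (intro tendsto_inner lim tendsto_const)+
    moreover have "P (r k) x \<bullet> y = P (r k) x \<bullet> P (r k) y" for k
      by (metis P inner_orth_proj[OF S])
    ultimately show ?thesis using LIMSEQ_unique by auto
  qed
  define L where "L = range (blinfun_apply Q)"
  have L: "subspace L"
    unfolding L_def by (intro linear_subspace_image bounded_linear.linear[OF blinfun.bounded_linear_right]) simp
  \<comment> \<open>By \<open>sym\<close>, \<open>z - Q z\<close> is orthogonal to the whole range
    of \<open>Q\<close>.\<close>
  have QL: "orth_proj L z = Q z" for z
    using sym by (intro orth_proj_eqI L)
      (auto simp: L_def orthogonal_comp_def orthogonal_def inner_diff_right)
  have norm_eq: "onorm (\<lambda>z. orth_proj L z - orth_proj (S (r k)) z) = norm (Q - P (r k))" for k
    by (simp add: norm_blinfun.rep_eq QL P minus_blinfun.rep_eq)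
  have to0: "(\<lambda>k. norm (Q - P (r k))) \<longlonglongrightarrow> 0"
    using tendsto_norm[OF tendsto_diff[OF tendsto_const[of Q] Q]] by simp
  then have "\<forall>\<^sub>F k in sequentially. norm (Q - P (r k)) < 1"
    by (rule order_tendstoD) simp
  then obtain k where k: "norm (Q - P (r k)) < 1" by (auto simp: eventually_sequentially)
  have close: "norm (orth_proj L z - orth_proj (S (r k)) z) < norm z" if "z \<noteq> 0" for z
  proof -
    have "norm ((Q - P (r k)) z) \<le> norm (Q - P (r k)) * norm z" by (rule norm_blinfun)
    also have "\<dots> < 1 * norm z" using k that by (intro mult_strict_right_mono) auto
    finally show ?thesis by (simp add: QL P blinfun.diff_left)
  qed
  have "dim L = d"
    using dim_le_of_close[OF L S[of "r k"]] dim_le_of_close[OF S[of "r k"] L] close d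
    by (metis norm_minus_commute order_antisym)
  with that[OF L _ r] to0 norm_eq show thesis by simp
qed

section \<open>The metric on subspaces and limits of \<open>Sstar\<close>\<close>

text \<open>The orthogonal complement of an arbitrary set is a subspace, and so is its image under a
  linear map. Hence the triangle inequality for \<open>dZ\<close> applies directly to adjoints of
  tangent cones.\<close>

lemma subspace_adj_subspace: "subspace (adj_subspace L)"
proof -
  have "adj_subspace L = (\<lambda>p. (- snd p, fst p)) ` orthogonal_comp L"
    unfolding adj_subspace_def by force
  moreover have "linear (\<lambda>p::'a \<times> 'a. (- snd p, fst p))"
    by (rule linearI) auto
  ultimately show ?thesis
    using linear_subspace_image subspace_orthogonal_comp by metis
qed

lemma dZ_triangle:
  assumes "subspace L" "subspace M" "subspace N"
  shows "dZ L N \<le> dZ L M + dZ M N"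
proof -
  have "onorm (\<lambda>z. (orth_proj L z - orth_proj M z) + (orth_proj M z - orth_proj N z))
     \<le> dZ L M + dZ M N"
    unfolding dZ_def using assms
    by (intro onorm_triangle bounded_linear_sub bounded_linear_orth_proj)
  then show ?thesis by (simp add: dZ_def)
qed

lemma dZ_nonneg: "subspace L \<Longrightarrow> subspace M \<Longrightarrow> dZ L M \<ge> 0"
  unfolding dZ_def by (intro onorm_pos_le bounded_linear_sub bounded_linear_orth_proj)

lemma Sstar_approx:
  assumes "L \<in> Sstar F x y" "e > 0"
  obtains z where "z \<in> OF_pts F" "dist z (x, y) < e"
    "dZ L (adj_subspace (tangent_cone (gph F) z)) < e"
proof -
  obtain z where z: "\<And>k. z k \<in> OF_pts F" "z \<longlonglongrightarrow> (x, y)"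
    "(\<lambda>k. dZ L (adj_subspace (tangent_cone (gph F) (z k)))) \<longlonglongrightarrow> 0"
    using assms(1) unfolding Sstar_def by blast
  have "\<forall>\<^sub>F k in sequentially. dist (z k) (x, y) < e \<and>
      dZ L (adj_subspace (tangent_cone (gph F) (z k))) < e"
    using tendstoD[OF z(2) assms(2)] order_tendstoD(2)[OF z(3) assms(2)]
    by (rule eventually_conj)
  then show thesis using that z(1) eventually_happens'[OF sequentially_bot] by blast
qed

text \<open>A diagonal argument: compactness provides a limit \<open>M\<close> of a subsequence of
  \<open>L\<close>, and each \<open>L k\<close> is replaced by the adjoint of a tangent cone at a
  nearby point of \<open>OF_pts F\<close>, with an error that vanishes as \<open>k\<close>
  grows.\<close>

lemma Sstar_limit:
  fixes z :: "nat \<Rightarrow> 'a::euclidean_space \<times> 'a"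
  assumes z: "z \<longlonglongrightarrow> (x, y)" and L: "\<And>k. L k \<in> Sstar F (fst (z k)) (snd (z k))"
  obtains M r where "M \<in> Sstar F x y" "strict_mono (r :: nat \<Rightarrow> nat)"
    "(\<lambda>k. dZ M (L (r k))) \<longlonglongrightarrow> 0"
proof -
  have Zn: "subspace (L k)" "dim (L k) = DIM('a)" for k
    using L[of k] by (auto simp: Sstar_def Zn_def)
  obtain M r where M: "subspace M" "dim M = DIM('a)" "strict_mono (r :: nat \<Rightarrow> nat)"
    "(\<lambda>k. dZ M (L (r k))) \<longlonglongrightarrow> 0"
    unfolding dZ_def by (rule subspaces_sequentially_compact[OF Zn])
  let ?T = "\<lambda>p. adj_subspace (tangent_cone (gph F) p)"
  have "\<exists>p. p \<in> OF_pts F \<and> dist p (z k) < 1 / Suc k \<and> dZ (L k) (?T p) < 1 / Suc k" for k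
    by (rule Sstar_approx[OF L[of k], of "1 / Suc k"]) auto
  then obtain p where p: "\<And>k. p k \<in> OF_pts F" "\<And>k. dist (p k) (z k) < 1 / Suc k"
    "\<And>k. dZ (L k) (?T (p k)) < 1 / Suc k" by metis
  have inv0: "(\<lambda>k. 1 / real (Suc k)) \<longlonglongrightarrow> 0"
    using LIMSEQ_inverse_real_of_nat by (simp add: inverse_eq_divide)
  have "(\<lambda>k. p k - z k) \<longlonglongrightarrow> 0"
    by (rule Lim_null_comparison[OF _ inv0]) (use p(2) in \<open>intro always_eventually allI less_imp_le; simp add: dist_norm\<close>)
  then have "p \<longlonglongrightarrow> (x, y)"
    using tendsto_add[OF _ z] by fastforce
  then have pr: "(\<lambda>k. p (r k)) \<longlonglongrightarrow> (x, y)"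
    using LIMSEQ_subseq_LIMSEQ[OF _ M(3), unfolded o_def] by blast
  have up: "(\<lambda>k. dZ M (L (r k)) + 1 / real (Suc (r k))) \<longlonglongrightarrow> 0"
    using tendsto_add[OF M(4) LIMSEQ_subseq_LIMSEQ[OF inv0 M(3)]] by (simp add: o_def)
  have "(\<lambda>k. dZ M (?T (p (r k)))) \<longlonglongrightarrow> 0"
  proof (rule tendsto_sandwich[OF _ _ tendsto_const up])
    show "\<forall>\<^sub>F k in sequentially. 0 \<le> dZ M (?T (p (r k)))"
      by (intro always_eventually allI dZ_nonneg M(1) subspace_adj_subspace)
    have "dZ M (?T (p (r k))) \<le> dZ M (L (r k)) + 1 / real (Suc (r k))" for k
      using dZ_triangle[OF M(1) Zn(1)[of "r k"] subspace_adj_subspace, of "tangent_cone (gph F) (p (r k))"]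
        p(3)[of "r k"] by linarith
    then show "\<forall>\<^sub>F k in sequentially. dZ M (?T (p (r k))) \<le> dZ M (L (r k)) + 1 / real (Suc (r k))"
      by (intro always_eventually allI)
  qed
  then have "M \<in> Sstar F x y"
    unfolding Sstar_def Zn_def using M(1,2) pr p(1)
    by (intro CollectI conjI exI[of _ "\<lambda>k. p (r k)"]) auto
  with that M(3,4) show thesis by blast
qed

text \<open>Since \<open>v k\<close> is fixed by the projection onto \<open>L k\<close>, its
  distance to its projection onto \<open>M\<close> is at most
  \<open>dZ M (L k) * norm (v k)\<close>, which tends to zero. In the limit \<open>w\<close> is
  fixed by the projection onto \<open>M\<close>.\<close>

lemma mem_of_dZ_limit:
  assumes L: "\<And>k. subspace (L k)" and M: "subspace M" and d: "(\<lambda>k. dZ M (L k)) \<longlonglongrightarrow> 0"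
    and v: "\<And>k. v k \<in> L k" "v \<longlonglongrightarrow> w"
  shows "w \<in> M"
proof -
  have "norm (orth_proj M (v k) - v k) \<le> dZ M (L k) * norm (v k)" for k
    using onorm[OF bounded_linear_sub[OF bounded_linear_orth_proj[OF M] bounded_linear_orth_proj[OF L[of k]]], of "v k"]
    by (simp add: dZ_def orth_proj_fixed[OF L v(1)])
  then have le: "\<forall>\<^sub>F k in sequentially. norm (orth_proj M (v k) - v k) \<le> dZ M (L k) * norm (v k)"
    by (intro always_eventually allI)
  have "(\<lambda>k. dZ M (L k) * norm (v k)) \<longlonglongrightarrow> 0"
    using tendsto_mult[OF d tendsto_norm[OF v(2)]] by simp
  with le have "(\<lambda>k. orth_proj M (v k) - v k) \<longlonglongrightarrow> 0"
    by (rule Lim_null_comparison)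
  moreover have "(\<lambda>k. orth_proj M (v k) - v k) \<longlonglongrightarrow> orth_proj M w - w"
    by (intro tendsto_diff v bounded_linear.tendsto[OF bounded_linear_orth_proj[OF M]])
  ultimately have "orth_proj M w = w" using LIMSEQ_unique[of _ 0 "orth_proj M w - w"] by simp
  then show ?thesis using orth_proj_mem[OF M] by metis
qed

section \<open>Uniform bound on \<open>Sstar\<close> near a regular point\<close>

text \<open>Otherwise there are violating unit vectors at points converging to
  \<open>(x, y)\<close>. By compactness they have a limit in a subspace from
  \<open>Sstar F x y\<close>, and this limit contradicts either regularity or the value of the
  modulus.\<close>

lemma scd_reg_bound_near:
  fixes F :: "'a::euclidean_space \<Rightarrow> 'a set"
  assumes reg: "Sstar F x y \<subseteq> Zn_reg" and \<kappa>: "scd_reg F x y < ereal \<kappa>"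
  obtains W where "open W" "(x, y) \<in> W"
    "\<forall>z\<in>W. \<forall>p\<in>\<Union>(Sstar F (fst z) (snd z)). norm (fst p) \<le> \<kappa> * norm (snd p)"
proof -
  have "\<exists>e>0. \<forall>z\<in>ball (x, y) e. \<forall>p\<in>\<Union>(Sstar F (fst z) (snd z)). norm (fst p) \<le> \<kappa> * norm (snd p)"
  proof (rule ccontr)
    assume neg: "\<not> ?thesis"
    \<comment> \<open>The violated bound is homogeneous, so a violating vector, nonzero by
      strictness, can be scaled to norm one. The weak inequality is kept because it is the one that
      passes to the limit.\<close>
    have "\<exists>z L p. dist (x, y) z < 1 / Suc k \<and> L \<in> Sstar F (fst z) (snd z) \<and> p \<in> L \<and>
        norm p = 1 \<and> norm (fst p) \<ge> \<kappa> * norm (snd p)" for k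
    proof -
      have "1 / real (Suc k) > 0" by simp
      then obtain z L p where p: "dist (x, y) z < 1 / Suc k" "L \<in> Sstar F (fst z) (snd z)" "p \<in> L"
        "norm (fst p) > \<kappa> * norm (snd p)"
        using neg by (meson UnionE mem_ball not_le)
      have "p \<noteq> 0" using p(4) by auto
      moreover have "p /\<^sub>R norm p \<in> L"
        using p by (intro subspace_scale) (auto simp: Sstar_def Zn_def)
      moreover have "norm (fst (p /\<^sub>R norm p)) \<ge> \<kappa> * norm (snd (p /\<^sub>R norm p))"
        using p(4) \<open>p \<noteq> 0\<close> by (simp add: divide_simps)
      ultimately show ?thesis using p(1,2)
        by (intro exI[of _ z] exI[of _ L] exI[of _ "p /\<^sub>R norm p"]) simp
    qed
    then obtain z L p where z: "\<And>k. dist (x, y) (z k) < 1 / Suc k"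
      and L: "\<And>k. L k \<in> Sstar F (fst (z k)) (snd (z k))"
      and p: "\<And>k. p k \<in> L k" "\<And>k. norm (p k) = 1"
        "\<And>k. norm (fst (p k)) \<ge> \<kappa> * norm (snd (p k))"
      by metis
    have "(\<lambda>k. dist (z k) (x, y)) \<longlonglongrightarrow> 0"
      using z LIMSEQ_inverse_real_of_nat
      by (intro tendsto_sandwich[OF _ _ tendsto_const LIMSEQ_inverse_real_of_nat])
        (auto intro!: always_eventually less_imp_le simp: inverse_eq_divide dist_commute)
    then have zlim: "z \<longlonglongrightarrow> (x, y)" using tendsto_dist_iff by blast
    obtain M r where M: "M \<in> Sstar F x y" "strict_mono (r :: nat \<Rightarrow> nat)"
      "(\<lambda>k. dZ M (L (r k))) \<longlonglongrightarrow> 0" using Sstar_limit[OF zlim L] by blast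
    have "bounded (range (\<lambda>k. p (r k)))" using p(2) by (auto simp: bounded_iff)
    then obtain q s where s: "strict_mono (s :: nat \<Rightarrow> nat)" and q: "(\<lambda>k. p (r (s k))) \<longlonglongrightarrow> q"
      using bounded_imp_convergent_subsequence[of "\<lambda>k. p (r k)"] by (auto simp: o_def)
    have subM: "subspace M" using M(1) by (auto simp: Sstar_def Zn_def)
    have subL: "subspace (L k)" for k using L[of k] by (auto simp: Sstar_def Zn_def)
    have "(\<lambda>k. dZ M (L (r (s k)))) \<longlonglongrightarrow> 0"
      using LIMSEQ_subseq_LIMSEQ[OF M(3) s] by (simp add: o_def)
    then have qM: "q \<in> M"
      using mem_of_dZ_limit[OF subL subM _ p(1) q] by blast
    have q1: "norm q = 1"
      using tendsto_norm[OF q] p(2) LIMSEQ_unique[OF tendsto_const] by force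
    have q\<kappa>: "\<kappa> * norm (snd q) \<le> norm (fst q)"
      by (rule LIMSEQ_le[of "\<lambda>k. \<kappa> * norm (snd (p (r (s k))))" _ "\<lambda>k. norm (fst (p (r (s k))))"])
        (use p(3) q in \<open>auto intro!: tendsto_intros\<close>)
    have "snd q \<noteq> 0"
    proof
      assume "snd q = 0"
      then have "(fst q, 0) \<in> M" using qM by (metis prod.collapse)
      moreover have "M \<in> Zn_reg" using reg M(1) by blast
      ultimately have "fst q = 0" by (simp add: Zn_reg_def)
      with \<open>snd q = 0\<close> q1 show False by (simp add: norm_prod_def)
    qed
    \<comment> \<open>Scaling the second component to norm one makes \<open>c\<close> a competitor
      in the supremum defining \<open>scd_reg F x y\<close>, although its first component has norm
      at least \<open>\<kappa>\<close>.\<close>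
    define c where "c = q /\<^sub>R norm (snd q)"
    have "c \<in> M" unfolding c_def using subM qM by (rule subspace_scale)
    then have "(fst c, snd c) \<in> \<Union>(Sstar F x y)" using M(1) by auto
    moreover have "norm (snd c) \<le> 1" using \<open>snd q \<noteq> 0\<close> by (simp add: c_def)
    ultimately have "ereal (norm (fst c)) \<le> scd_reg F x y"
      unfolding scd_reg_def by (intro Sup_upper) blast
    moreover have "\<kappa> \<le> norm (fst c)"
      using q\<kappa> \<open>snd q \<noteq> 0\<close> by (simp add: c_def divide_simps)
    ultimately show False using \<kappa> by (metis ereal_less_eq(3) leD order_trans)
  qed
  then obtain e where e: "e > 0"
    "\<forall>z\<in>ball (x, y) e. \<forall>p\<in>\<Union>(Sstar F (fst z) (snd z)). norm (fst p) \<le> \<kappa> * norm (snd p)"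
    by blast
  show thesis
    by (rule that[OF open_ball _ e(2)]) (use e(1) in simp)
qed

section \<open>From semismoothness to a local estimate\<close>

text \<open>The bound forces \<open>u = 0\<close> whenever \<open>v = 0\<close>, so
  \<open>snd\<close> is injective on \<open>L\<close>. As \<open>L\<close> has the dimension of the
  target space, \<open>snd\<close> is also onto.\<close>

lemma Zn_snd_surj:
  fixes L :: "('a::euclidean_space \<times> 'a) set"
  assumes L: "L \<in> Zn" and b: "\<And>u v. (u, v) \<in> L \<Longrightarrow> norm u \<le> \<kappa> * norm v"
  obtains u where "(u, v) \<in> L"
proof -
  have sub: "subspace L" and dim: "dim L = DIM('a)" using L by (auto simp: Zn_def)
  have lin: "linear (snd :: 'a \<times> 'a \<Rightarrow> 'a)" by (rule linearI) auto
  have "inj_on snd L"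
  proof (rule inj_onI)
    fix p q assume pq: "p \<in> L" "q \<in> L" "snd p = snd q"
    then have "(fst p - fst q, snd p - snd q) \<in> L"
      using subspace_diff[OF sub pq(1,2)] by (simp add: minus_prod_def)
    from b[OF this] pq(3) show "p = q" by (simp add: prod_eq_iff)
  qed
  then have "dim (snd ` L) = DIM('a)"
    using dim_image_eq[OF lin, of L] sub dim by (simp add: span_eq_iff[THEN iffD2])
  then have "snd ` L = UNIV"
    using dim_eq_full[of "snd ` L"] linear_subspace_image[OF lin sub] by (simp add: span_eq_iff[THEN iffD2])
  then show thesis using that by (metis UNIV_I imageE prod.collapse)
qed

lemma semismooth_estimate:
  fixes F :: "'a::euclidean_space \<Rightarrow> 'a set"
  assumes ss: "scd_semismooth_at F x y" and W: "open W" "(x, y) \<in> W"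
    and bound: "\<forall>z\<in>W. \<forall>p\<in>\<Union>(Sstar F (fst z) (snd z)). norm (fst p) \<le> \<kappa> * norm (snd p)"
    and \<kappa>: "0 \<le> \<kappa>" "\<kappa> < \<mu>"
  obtains \<delta> where "\<delta> > 0"
    "\<forall>x' y'. (x', y') \<in> gph F \<longrightarrow> dist (x', y') (x, y) < \<delta> \<longrightarrow> norm (x' - x) \<le> \<mu> * norm (y' - y)"
proof -
  \<comment> \<open>Chosen so that the error term
    \<open>\<epsilon> * (1 + \<kappa>) * (a + b)\<close> below, with
    \<open>a = norm (x' - x)\<close> and \<open>b = norm (y' - y)\<close>, can be absorbed by
    enlarging \<open>\<kappa>\<close> to exactly \<open>\<mu>\<close>.\<close>
  define \<epsilon> where "\<epsilon> = (\<mu> - \<kappa>) / ((1 + \<kappa>) * (1 + \<mu>))"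
  have \<epsilon>: "\<epsilon> > 0" using \<kappa> by (simp add: \<epsilon>_def)
  have eq: "\<epsilon> * (1 + \<kappa>) * (1 + \<mu>) = \<mu> - \<kappa>" using \<kappa> by (simp add: \<epsilon>_def)
  have "\<exists>\<delta>>0. \<forall>(x', y') \<in> gph F \<inter> cball (x, y) \<delta>. \<forall>(u, v) \<in> \<Union>(Sstar F x' y').
        \<bar>v \<bullet> (x' - x) - u \<bullet> (y' - y)\<bar> \<le> \<epsilon> * norm ((x', y') - (x, y)) * norm (v, u)"
    using ss \<epsilon> unfolding scd_semismooth_at_def by simp
  then obtain \<delta> where \<delta>: "\<delta> > 0" and
    "\<forall>(x', y') \<in> gph F \<inter> cball (x, y) \<delta>. \<forall>(u, v) \<in> \<Union>(Sstar F x' y').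
        \<bar>v \<bullet> (x' - x) - u \<bullet> (y' - y)\<bar> \<le> \<epsilon> * norm ((x', y') - (x, y)) * norm (v, u)"
    by (elim exE conjE)
  then have est: "\<bar>v \<bullet> (x' - x) - u \<bullet> (y' - y)\<bar> \<le> \<epsilon> * norm (x' - x, y' - y) * norm (v, u)"
    if "(x', y') \<in> gph F" "(x', y') \<in> cball (x, y) \<delta>" "L \<in> Sstar F x' y'" "(u, v) \<in> L" for x' y' u v L
    using that by fastforce
  have "scd_property_around F x y" using ss by (simp add: scd_semismooth_at_def)
  \<comment> \<open>Nonemptiness of \<open>Sstar\<close> at nearby graph points matters: the
    semismoothness inequality says nothing where \<open>Sstar\<close> is empty.\<close>
  then obtain U where U: "open U" "(x, y) \<in> U"
    and ne: "\<forall>(x', y') \<in> gph F \<inter> U. Sstar F x' y' \<noteq> {}"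
    unfolding scd_property_around_def scd_property_at_def by (elim exE conjE)
  have "open (U \<inter> W)" "(x, y) \<in> U \<inter> W" using U W by auto
  then obtain d where d: "d > 0" "ball (x, y) d \<subseteq> U \<inter> W" using open_contains_ball by blast
  show thesis
  proof (rule that[of "min d \<delta>"]; (intro allI impI)?)
    fix x' y' assume g: "(x', y') \<in> gph F" and dd: "dist (x', y') (x, y) < min d \<delta>"
    then have "(x', y') \<in> ball (x, y) d" by (simp add: dist_commute)
    then have UW: "(x', y') \<in> U" "(x', y') \<in> W" using d by auto
    then obtain L where L: "L \<in> Sstar F x' y'" using ne g by blast
    have bL: "norm u \<le> \<kappa> * norm v" if "(u, v) \<in> L" for u v
      using bspec[OF bspec[OF bound UW(2)], of "(u, v)"] L that by auto
    have "L \<in> Zn" using L by (simp add: Sstar_def)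
    \<comment> \<open>With \<open>x' - x\<close> as second component, the first inner product of the
      semismoothness inequality becomes the square of \<open>norm (x' - x)\<close>.\<close>
    then obtain u where u: "(u, x' - x) \<in> L" using bL by (rule Zn_snd_surj)
    define a b where "a = norm (x' - x)" and "b = norm (y' - y)"
    have ab: "a \<ge> 0" "b \<ge> 0" by (auto simp: a_def b_def)
    have ua: "norm u \<le> \<kappa> * a" using bL[OF u] by (simp add: a_def)
    have "\<bar>(x' - x) \<bullet> (x' - x) - u \<bullet> (y' - y)\<bar> \<le> \<epsilon> * norm (x' - x, y' - y) * norm (x' - x, u)"
      using est[OF g _ L u] dd by (simp add: dist_commute)
    also have "\<dots> \<le> \<epsilon> * (a + b) * (a + \<kappa> * a)"
      using \<epsilon> ua ab norm_Pair_le[of "x' - x" "y' - y"] norm_Pair_le[of "x' - x" u]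
      by (intro mult_mono) (auto simp: a_def b_def)
    finally have "a * a \<le> u \<bullet> (y' - y) + \<epsilon> * (a + b) * (a + \<kappa> * a)"
      by (simp add: a_def dot_square_norm power2_eq_square)
    moreover have "u \<bullet> (y' - y) \<le> \<kappa> * a * b"
      using norm_cauchy_schwarz[of u "y' - y"] mult_right_mono[OF ua ab(2)] by (simp add: b_def)
    ultimately have "a * a \<le> a * (\<kappa> * b + \<epsilon> * (1 + \<kappa>) * (a + b))" by (simp add: algebra_simps)
    \<comment> \<open>Division by \<open>a\<close>; for \<open>a = 0\<close> the right-hand side is
      nonnegative.\<close>
    then have le: "a \<le> \<kappa> * b + \<epsilon> * (1 + \<kappa>) * (a + b)"
      using ab \<epsilon> \<kappa> by (cases "a = 0") auto
    \<comment> \<open>Multiplying by \<open>1 + \<mu>\<close> clears the denominator left in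
      \<open>\<epsilon> * (1 + \<kappa>)\<close>; collecting the terms in \<open>a\<close> and
      \<open>b\<close> then leaves the common factor \<open>1 + \<kappa>\<close>.\<close>
    have "(1 + \<mu>) * a \<le> (1 + \<mu>) * (\<kappa> * b) + (\<mu> - \<kappa>) * (a + b)"
      using mult_left_mono[OF le, of "1 + \<mu>"] \<kappa> by (simp add: eq[symmetric] algebra_simps)
    then have "(1 + \<kappa>) * a \<le> (1 + \<kappa>) * (\<mu> * b)" by (simp add: algebra_simps)
    then show "norm (x' - x) \<le> \<mu> * norm (y' - y)" using \<kappa> by (simp add: a_def b_def)
  qed (use d \<delta> in auto)
qed

section \<open>From the local estimate to strong metric subregularity\<close>

lemma strong_subregularity_of_estimate:
  fixes F :: "'a::euclidean_space \<Rightarrow> 'a set"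
  assumes g: "(x, y) \<in> gph F" and \<mu>: "\<mu> > 0" and \<delta>: "\<delta> > 0"
    and est: "\<forall>x' y'. (x', y') \<in> gph F \<longrightarrow> dist (x', y') (x, y) < \<delta> \<longrightarrow> norm (x' - x) \<le> \<mu> * norm (y' - y)"
  shows "subreg_const F x y \<mu>" "strongly_metrically_subregular F x y"
proof -
  \<comment> \<open>Subregularity restricts \<open>x'\<close> but not \<open>y'\<close>. The first
    bound brings \<open>(x', y')\<close> within \<open>\<delta>\<close> when \<open>y'\<close> is
    close to \<open>y\<close>; the second makes the claim hold trivially when \<open>y'\<close> is
    at distance at least \<open>\<delta> / 2\<close>.\<close>
  define \<rho> where "\<rho> = min (\<delta> / 2) (\<mu> * (\<delta> / 2))"
  have \<rho>: "\<rho> > 0" using \<mu> \<delta> by (simp add: \<rho>_def)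
  have main: "dist x' x \<le> \<mu> * dist y y'" if x': "x' \<in> ball x \<rho>" and y': "y' \<in> F x'" for x' y'
  proof (cases "dist y y' < \<delta> / 2")
    case True
    have "dist (x', y') (x, y) \<le> dist x' x + dist y y'"
      using norm_Pair_le[of "x' - x" "y' - y"] by (simp add: dist_norm norm_minus_commute)
    also have "\<dots> < \<delta>" using True x' by (simp add: \<rho>_def dist_commute)
    finally have "norm (x' - x) \<le> \<mu> * norm (y' - y)" using est y' by (simp add: gph_def)
    then show ?thesis by (simp add: dist_norm norm_minus_commute)
  next
    case False
    then have "\<mu> * (\<delta> / 2) \<le> \<mu> * dist y y'" using \<mu> by (intro mult_left_mono) auto
    then show ?thesis using x' by (simp add: \<rho>_def dist_commute)
  qed
  have "set_edist x' (preimg F y) \<le> ereal \<mu> * set_edist y (F x')" if x': "x' \<in> ball x \<rho>" for x'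
  proof -
    have "set_edist x' (preimg F y) \<le> ereal (dist x' x)"
      unfolding set_edist_def using g by (intro INF_lower) (simp add: preimg_def gph_def)
    \<comment> \<open>For empty \<open>F x'\<close> the infimum is \<open>\<infinity>\<close>, and
      it stays so when the positive factor \<open>\<mu>\<close> is pulled out in the next
      step.\<close>
    also have "\<dots> \<le> (INF y'\<in>F x'. ereal \<mu> * ereal (dist y y'))"
      using main[OF x'] by (intro INF_greatest) simp
    also have "\<dots> = ereal \<mu> * set_edist y (F x')"
      using ereal_Inf_cmult[OF \<mu>, of "\<lambda>e. e \<in> (\<lambda>a. ereal (dist y a)) ` F x'"]
      by (simp add: set_edist_def setcompr_eq_image image_image)
    finally show ?thesis .
  qed
  then show sc: "subreg_const F x y \<mu>"
    unfolding subreg_const_def using \<mu> \<rho> by (intro conjI exI[of _ "ball x \<rho>"]) auto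
  \<comment> \<open>At \<open>y' = y\<close> the inequality \<open>main\<close> gives
    \<open>dist x' x \<le> 0\<close>.\<close>
  have "preimg F y \<inter> ball x \<rho> = {x}"
    using main[of _ y] g \<rho> by (force simp: preimg_def gph_def)
  then show "strongly_metrically_subregular F x y"
    unfolding strongly_metrically_subregular_def metrically_subregular_def
    using g sc \<rho> by (intro conjI exI[of _ \<mu>] exI[of _ "ball x \<rho>"]) auto
qed

section \<open>Choice of constants and conclusion\<close>

theorem theorem6p2:
  fixes F :: "real ^ 'n \<Rightarrow> (real ^ 'n) set" and xbar ybar :: "real ^ 'n"
  assumes "(xbar, ybar) \<in> gph F"
    and "locally_closed_around (gph F) (xbar, ybar)"
    and "scd_regular_around F xbar ybar"
  shows "\<forall>\<kappa>::real. ereal \<kappa> > scd_reg F xbar ybar \<longrightarrow>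
    (\<exists>W. open W \<and> (xbar, ybar) \<in> W \<and>
      (\<forall>(x, y) \<in> gph F \<inter> W. scd_semismooth_at F x y \<longrightarrow>
        strongly_metrically_subregular F x y \<and> subreg F x y < ereal \<kappa>))"
proof (intro allI impI)
  fix \<kappa> :: real assume \<kappa>: "ereal \<kappa> > scd_reg F xbar ybar"
  have reg: "Sstar F xbar ybar \<subseteq> Zn_reg" and ne: "Sstar F xbar ybar \<noteq> {}"
    using assms unfolding scd_regular_around_def scd_property_around_def scd_property_at_def by blast+
  obtain L where L: "L \<in> Sstar F xbar ybar" using ne by blast
  then have "subspace L" by (simp add: Sstar_def Zn_def)
  \<comment> \<open>The zero vector competes in the supremum, so the modulus is nonnegative, and so
    is every real constant above it.\<close>
  then have "(0, 0) \<in> L" using subspace_0[of L] by (simp add: zero_prod_def)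
  then have "ereal (norm (0 :: real ^ 'n)) \<le> scd_reg F xbar ybar"
    using L unfolding scd_reg_def by (intro Sup_upper) force
  then have "0 \<le> scd_reg F xbar ybar" by (simp add: zero_ereal_def)
  moreover obtain \<kappa>1 where \<kappa>1: "scd_reg F xbar ybar < ereal \<kappa>1" "ereal \<kappa>1 < ereal \<kappa>"
    using ereal_dense2[OF \<kappa>] by blast
  ultimately have "0 \<le> \<kappa>1" by (metis ereal_less_eq(5) less_imp_le order_trans)
  \<comment> \<open>Two constants are needed below \<open>\<kappa>\<close>: \<open>\<kappa>1\<close>
    bounds the subspaces near the reference point, and the gap up to \<open>\<mu>\<close> absorbs
    the semismoothness error. Strictness of \<open>\<mu> < \<kappa>\<close> gives the strict bound
    on \<open>subreg\<close>.\<close>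
  obtain \<mu> where \<mu>: "\<kappa>1 < \<mu>" "\<mu> < \<kappa>" using \<kappa>1(2) dense by force
  obtain W where W: "open W" "(xbar, ybar) \<in> W"
    "\<forall>z\<in>W. \<forall>p\<in>\<Union>(Sstar F (fst z) (snd z)). norm (fst p) \<le> \<kappa>1 * norm (snd p)"
    by (rule scd_reg_bound_near[OF reg \<kappa>1(1)])
  have "strongly_metrically_subregular F x y \<and> subreg F x y < ereal \<kappa>"
    if xy: "(x, y) \<in> gph F" "(x, y) \<in> W" and ss: "scd_semismooth_at F x y" for x y
  proof -
    obtain \<delta> where \<delta>: "\<delta> > 0" "\<forall>x' y'. (x', y') \<in> gph F \<longrightarrow> dist (x', y') (x, y) < \<delta> \<longrightarrow>
        norm (x' - x) \<le> \<mu> * norm (y' - y)"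
      by (rule semismooth_estimate[OF ss W(1) xy(2) W(3) \<open>0 \<le> \<kappa>1\<close> \<mu>(1)])
    have "\<mu> > 0" using \<mu> \<open>0 \<le> \<kappa>1\<close> by simp
    note sub = strong_subregularity_of_estimate[OF xy(1) this \<delta>]
    have "subreg F x y \<le> ereal \<mu>"
      unfolding subreg_def using sub(1) by (intro Inf_lower) blast
    also have "\<dots> < ereal \<kappa>" using \<mu> by simp
    finally show ?thesis using sub(2) by blast
  qed
  then show "\<exists>W. open W \<and> (xbar, ybar) \<in> W \<and>
      (\<forall>(x, y) \<in> gph F \<inter> W. scd_semismooth_at F x y \<longrightarrow>
        strongly_metrically_subregular F x y \<and> subreg F x y < ereal \<kappa>)"
    using W(1,2) by (intro exI[of _ W]) auto
qed

end
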